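(* Let $\varrho\colon C\to[0,1]$ be a default risk measure. Then the following statements are equivalent. \begin{enumerate} \item[(i)] $\varrho$ is law-invariant and $\varrho(X)=\varrho\big(\mathbf 1_{\{X>0\}}\big)$ for all $X\in C$. \item[(ii)] There exists a distortion function $T\colon[0,1]\to[0,1]$ with \[ \varrho(X)=T\big(\mathbb{P}(X>0)\big)\quad\text{for all }X\in C. \] \end{enumerate}
   Context: $(\Omega,\mathcal F,\mathbb{P})$ is a probability space and $\mathrm{B}_{\mathrm b}$ is the space of all bounded measurable functions $\Omega\to\mathbb{R}$, ordered pointwise; real constants are identified with constant functions. $C\subset \mathrm{B}_{\mathrm b}$ is a set containing all constant functions and satisfying $\mathbf 1_{\{X>0\}}\in C$ for all $X\in C$. A map $\varrho\colon C\to[0,1]$ is a default risk measure if (i) $\varrho(X)\le\varrho(Y)$ for all $X,Y\in C$ with $X\le Y$, and (ii) $\varrho(0)=0$ and $\varrho(m)=1$ for all real $m>0$. It is law-invariant if $\varrho(X)=\varrho(Y)$ whenever $X,Y\in C$ have the same distribution under $\mathbb{P}$. A distortion function is a function $T\colon[0,1]\to[0,1]$ with $T(0)=0$ and $T(1)=1$ (no monotonicity is required). *)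

theory Defs
  imports "HOL-Probability.Probability"
begin

text \<open>
  Functions on the sample space \<open>space M\<close> are represented by total functions on the underlying type.
  Values outside \<open>space M\<close> are irrelevant: the pointwise order below only looks at \<open>space M\<close>, so a
  monotone map takes the same value on functions that agree on \<open>space M\<close>.
\<close>

definition bounded_measurable :: "'a measure \<Rightarrow> ('a \<Rightarrow> real) set" where
  "bounded_measurable M = {X \<in> borel_measurable M. bounded (X ` space M)}"

definition pos_indicator :: "'a measure \<Rightarrow> ('a \<Rightarrow> real) \<Rightarrow> 'a \<Rightarrow> real" where
  "pos_indicator M X = indicator {\<omega> \<in> space M. X \<omega> > 0}"

definition admissible_domain :: "'a measure \<Rightarrow> ('a \<Rightarrow> real) set \<Rightarrow> bool" where
  "admissible_domain M C \<longleftrightarrow>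
     C \<subseteq> bounded_measurable M \<and>
     (\<forall>c. (\<lambda>_. c) \<in> C) \<and>
     (\<forall>X\<in>C. pos_indicator M X \<in> C)"

definition default_risk_measure ::
  "'a measure \<Rightarrow> ('a \<Rightarrow> real) set \<Rightarrow> (('a \<Rightarrow> real) \<Rightarrow> real) \<Rightarrow> bool" where
  "default_risk_measure M C \<rho> \<longleftrightarrow>
     \<rho> \<in> C \<rightarrow> {0..1} \<and>
     (\<forall>X\<in>C. \<forall>Y\<in>C. (\<forall>\<omega>\<in>space M. X \<omega> \<le> Y \<omega>) \<longrightarrow> \<rho> X \<le> \<rho> Y) \<and>
     \<rho> (\<lambda>_. 0) = 0 \<and>
     (\<forall>m>0. \<rho> (\<lambda>_. m) = 1)"

definition law_invariant ::
  "'a measure \<Rightarrow> ('a \<Rightarrow> real) set \<Rightarrow> (('a \<Rightarrow> real) \<Rightarrow> real) \<Rightarrow> bool" where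
  "law_invariant M C \<rho> \<longleftrightarrow>
     (\<forall>X\<in>C. \<forall>Y\<in>C. distr M borel X = distr M borel Y \<longrightarrow> \<rho> X = \<rho> Y)"

text \<open>Only the values on the unit interval matter; monotonicity is not required.\<close>

definition distortion_function :: "(real \<Rightarrow> real) \<Rightarrow> bool" where
  "distortion_function T \<longleftrightarrow> T \<in> {0..1} \<rightarrow> {0..1} \<and> T 0 = 0 \<and> T 1 = 1"

end

theory Submission
  imports Defs
begin

text \<open>The law of an indicator is a Bernoulli law, hence determined by the probability of its
  event (\<open>distr_indicator_cong\<close>). Under (i), \<rho> first reduces X to the indicator of
  {X > 0}, and law-invariance then leaves only the number P(X > 0); so \<rho> factors through X
  \<mapsto> P(X > 0), and T is the factor map. Conversely, P(X > 0) depends only on the law of X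
  (\<open>prob_pos_cong_distr\<close>) and does not change when X is replaced by that indicator
  (\<open>prob_pos_indicator\<close>), so any \<rho> of the form (ii) has both properties in
  (i).\<close>

lemma (in prob_space) distr_indicator_cong:
  assumes "A \<in> events" "B \<in> events" "prob A = prob B"
  shows "distr M borel (indicator A :: 'a \<Rightarrow> real) = distr M borel (indicator B)"
proof (rule measure_eqI)
  fix S :: "real set"
  assume "S \<in> sets (distr M borel (indicator A :: 'a \<Rightarrow> real))"
  then have S: "S \<in> sets borel" by simp
  \<comment> \<open>An indicator takes only the values 0 and 1, so the preimage of S depends only on
    which of these lie in S. The right-hand side involves D through \<open>prob D\<close>
    alone.\<close>
  have law: "emeasure (distr M borel (indicator D :: 'a \<Rightarrow> real)) S =
      ennreal (if 1 \<in> S then if 0 \<in> S then 1 else prob D else if 0 \<in> S then 1 - prob D else 0)"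
    if D: "D \<in> events" for D
  proof -
    have "(indicator D :: 'a \<Rightarrow> real) -` S \<inter> space M =
        (if 1 \<in> S then if 0 \<in> S then space M else D else if 0 \<in> S then space M - D else {})"
      using sets.sets_into_space[OF D] by (auto simp: indicator_def of_bool_def split: if_splits)
    then show ?thesis
      using D S by (simp add: emeasure_distr emeasure_eq_measure prob_compl prob_space)
  qed
  show "emeasure (distr M borel (indicator A :: 'a \<Rightarrow> real)) S =
      emeasure (distr M borel (indicator B)) S"
    using law assms by simp
qed simp

text \<open>Both sides are the mass that the common law gives to the open half-line
  \<open>{0<..}\<close>.\<close>

lemma prob_pos_cong_distr:
  fixes X Y :: "'a \<Rightarrow> real"
  assumes "X \<in> borel_measurable M" "Y \<in> borel_measurable M"
    and "distr M borel X = distr M borel Y"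
  shows "\<P>(\<omega> in M. X \<omega> > 0) = \<P>(\<omega> in M. Y \<omega> > 0)"
proof -
  have "\<P>(\<omega> in M. Z \<omega> > 0) = measure (distr M borel Z) {0<..}"
    if "Z \<in> borel_measurable M" for Z :: "'a \<Rightarrow> real"
    using that by (simp add: measure_distr vimage_def Int_def conj_commute)
  then show ?thesis
    using assms by simp
qed

text \<open>The two events are the same set, as an indicator is positive exactly on its
  event.\<close>

lemma prob_pos_indicator:
  "\<P>(\<omega> in M. pos_indicator M X \<omega> > 0) = \<P>(\<omega> in M. X \<omega> > 0)"
  by (rule arg_cong[where f = "measure M"]) (auto simp: pos_indicator_def indicator_def)

theorem theorem44:
  fixes M :: "'a measure"
    and C :: "('a \<Rightarrow> real) set"
    and \<rho> :: "('a \<Rightarrow> real) \<Rightarrow> real"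
  assumes "prob_space M"
    and "admissible_domain M C"
    and "default_risk_measure M C \<rho>"
  shows "(law_invariant M C \<rho> \<and> (\<forall>X\<in>C. \<rho> X = \<rho> (pos_indicator M X))) \<longleftrightarrow>
    (\<exists>T. distortion_function T \<and> (\<forall>X\<in>C. \<rho> X = T (\<P>(\<omega> in M. X \<omega> > 0))))"
proof -
  interpret prob_space M by fact
  let ?p = "\<lambda>X :: 'a \<Rightarrow> real. \<P>(\<omega> in M. X \<omega> > 0)"
  have meas: "X \<in> borel_measurable M" if "X \<in> C" for X
    using assms(2) that by (auto simp: admissible_domain_def bounded_measurable_def)
  have const: "(\<lambda>_. c) \<in> C" for c
    using assms(2) by (simp add: admissible_domain_def)
  have ind: "pos_indicator M X \<in> C" if "X \<in> C" for X
    using assms(2) that by (simp add: admissible_domain_def)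
  have range: "\<rho> X \<in> {0..1}" if "X \<in> C" for X
    using assms(3) that by (auto simp: default_risk_measure_def)
  have \<rho>_const: "\<rho> (\<lambda>_. 0) = 0" "\<rho> (\<lambda>_. 1) = 1"
    using assms(3) by (auto simp: default_risk_measure_def)
  show ?thesis
  proof
    assume "law_invariant M C \<rho> \<and> (\<forall>X\<in>C. \<rho> X = \<rho> (pos_indicator M X))"
    then have law: "law_invariant M C \<rho>" and pos: "\<And>X. X \<in> C \<Longrightarrow> \<rho> X = \<rho> (pos_indicator M X)"
      by blast+
    \<comment> \<open>X and Y may have different laws; law-invariance is applied to their
      indicators, which share a Bernoulli law, and \<open>pos\<close> carries the equality
      back.\<close>
    have determined: "\<rho> X = \<rho> Y" if "X \<in> C" "Y \<in> C" "?p X = ?p Y" for X Y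
    proof -
      have "distr M borel (pos_indicator M X) = distr M borel (pos_indicator M Y)"
        unfolding pos_indicator_def using that meas[of X] meas[of Y]
        by (intro distr_indicator_cong) auto
      then have "\<rho> (pos_indicator M X) = \<rho> (pos_indicator M Y)"
        using law ind that by (auto simp: law_invariant_def)
      then show ?thesis
        using pos[OF \<open>X \<in> C\<close>] pos[OF \<open>Y \<in> C\<close>] by argo
    qed
    \<comment> \<open>At an attained probability, T evaluates \<rho> at a chosen preimage;
      \<open>determined\<close> makes the choice immaterial. Elsewhere any value in the unit
      interval would do, and 0 is taken.\<close>
    define T where "T q = (if q \<in> ?p ` C then \<rho> (inv_into C ?p q) else 0)" for q
    have T: "T (?p X) = \<rho> X" if "X \<in> C" for X
    proof -
      have q: "?p X \<in> ?p ` C"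
        using that by (rule imageI)
      have "\<rho> (inv_into C ?p (?p X)) = \<rho> X"
        by (rule determined[OF inv_into_into[OF q] that f_inv_into_f[OF q]])
      then show ?thesis
        unfolding T_def using q by (simp only: if_True)
    qed
    have "T q \<in> {0..1}" for q
    proof (cases "q \<in> ?p ` C")
      case True
      then show ?thesis
        using range[OF inv_into_into[OF True]] by (simp only: T_def if_True)
    next
      case False
      then show ?thesis
        by (simp only: T_def if_False) simp
    qed
    \<comment> \<open>The constants 0 and 1 belong to C and attain the probabilities 0 and 1, so the
      normalisation of \<rho> fixes T at both endpoints.\<close>
    moreover have "T 0 = 0" "T 1 = 1"
      using T[OF const[of 0]] T[OF const[of 1]] \<rho>_const by (simp_all add: prob_space)
    ultimately have "distortion_function T"
      by (simp add: distortion_function_def)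
    with T show "\<exists>T. distortion_function T \<and> (\<forall>X\<in>C. \<rho> X = T (?p X))"
      by (intro exI[of _ T] conjI ballI) simp_all
  next
    assume "\<exists>T. distortion_function T \<and> (\<forall>X\<in>C. \<rho> X = T (?p X))"
    then obtain T where "distortion_function T \<and> (\<forall>X\<in>C. \<rho> X = T (?p X))" ..
    then have T: "\<rho> X = T (?p X)" if "X \<in> C" for X
      using that by simp
    have "law_invariant M C \<rho>"
      unfolding law_invariant_def
    proof (intro ballI impI)
      fix X Y
      assume X: "X \<in> C" and Y: "Y \<in> C" and "distr M borel X = distr M borel Y"
      then have "?p X = ?p Y"
        by (intro prob_pos_cong_distr meas)
      then show "\<rho> X = \<rho> Y"
        by (simp only: T[OF X] T[OF Y])
    qed
    moreover have "\<forall>X\<in>C. \<rho> X = \<rho> (pos_indicator M X)"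
      using T ind by (simp add: prob_pos_indicator)
    ultimately show "law_invariant M C \<rho> \<and> (\<forall>X\<in>C. \<rho> X = \<rho> (pos_indicator M X))" ..
  qed
qed

end
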